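(* Let $p\ge2$. For any $p$-ary groupoids $\mathbf{A},\mathbf{B}$ (so that $\sigma(\mathbf{A}),\sigma(\mathbf{B})\in FS$) the following holds: $\sigma(\mathbf{A})\prec\sigma(\mathbf{B})$ in the lattice $\mathbf{FS}$ if and only if there exists exactly one $n\in\mathbb{N}$ with $\sigma_n(\mathbf{A})\ne\sigma_n(\mathbf{B})$, and for this $n$ we have $\sigma_n(\mathbf{A})\prec\sigma_n(\mathbf{B})$ in the lattice $\mathrm{Eq}(B_n^{(p)})$.
   Context: $\mathbb{N}$ includes $0$; $p\ge 2$ is an integer. $T$ is the set of $p$-ary bracketings: terms (prefix notation) over the single variable $x$ and the $p$-ary operation symbol $\omega$, i.e. $x\in T$, and $\omega t_1\ldots t_p\in T$ whenever $t_1,\ldots,t_p\in T$. $|t|_\omega$ is the number of occurrences of $\omega$ in $t$; $B_n^{(p)}=\{t\in T:|t|_\omega=n\}$; $\Lambda^{(p)}=\{(s,t)\in T\times T:|s|_\omega=|t|_\omega\}$. A $p$-ary groupoid is an algebra with one $p$-ary operation. $\varepsilon_1(t)$ is the term obtained from $t$ by replacing the occurrences of $x$, from left to right, by distinct variables $x_1,x_2,\ldots$. The fine spectrum $\sigma(\mathbf{A})$ of a $p$-ary groupoid $\mathbf{A}$ is the set of all $(s,t)\in\Lambda^{(p)}$ such that $\mathbf{A}$ satisfies the identity $\varepsilon_1(s)\approx\varepsilon_1(t)$, and $\sigma_n(\mathbf{A})=\sigma(\mathbf{A})\cap(B_n^{(p)}\times B_n^{(p)})$. $FS$ is the set of all fine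 spectra of $p$-ary groupoids; ordered by inclusion it is a complete lattice $\mathbf{FS}$. $\mathrm{Eq}(B)$ is the lattice of equivalence relations on $B$ ordered by inclusion. $\prec$ denotes the covering relation ($a\prec b$ iff $a<b$ and there is no $c$ with $a<c<b$). *)

theory Defs
  imports "HOL-Library.Countable_Set"
begin

section \<open>Terms over one p-ary operation symbol\<close>

datatype 'v pterm = Var 'v | Omega "'v pterm list"

instance pterm :: (countable) countable
  by countable_datatype

text \<open>The datatype leaves the number of arguments open; the arity p is imposed here.\<close>

inductive_set pterms :: "nat \<Rightarrow> 'v set \<Rightarrow> 'v pterm set" for p :: nat and X :: "'v set" where
  var: "x \<in> X \<Longrightarrow> Var x \<in> pterms p X"
| omega: "length ts = p \<Longrightarrow> (\<And>t. t \<in> set ts \<Longrightarrow> t \<in> pterms p X) \<Longrightarrow> Omega ts \<in> pterms p X"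

text \<open>The single variable of a bracketing is the unique element of type \<^typ>\<open>unit\<close>.\<close>

definition bracketings :: "nat \<Rightarrow> unit pterm set" where
  "bracketings p = pterms p UNIV"

primrec num_omega :: "'v pterm \<Rightarrow> nat" where
  "num_omega (Var x) = 0"
| "num_omega (Omega ts) = Suc (sum_list (map num_omega ts))"

definition bracketings_n :: "nat \<Rightarrow> nat \<Rightarrow> unit pterm set" where
  "bracketings_n p n = {t \<in> bracketings p. num_omega t = n}"

definition Lam :: "nat \<Rightarrow> (unit pterm \<times> unit pterm) set" where
  "Lam p = {(s, t). s \<in> bracketings p \<and> t \<in> bracketings p \<and> num_omega s = num_omega t}"

primrec var_list :: "'v pterm \<Rightarrow> 'v list" where
  "var_list (Var x) = [x]"
| "var_list (Omega ts) = concat (map var_list ts)"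

text \<open>\<open>label k t\<close> replaces the variable occurrences of t, from left to right, by the variables
  with indices k, k + 1, k + 2, and so on.\<close>

fun label :: "nat \<Rightarrow> 'v pterm \<Rightarrow> nat pterm"
  and label_list :: "nat \<Rightarrow> 'v pterm list \<Rightarrow> nat pterm list" where
  "label k (Var x) = Var k"
| "label k (Omega ts) = Omega (label_list k ts)"
| "label_list k [] = []"
| "label_list k (t # ts) = label k t # label_list (k + length (var_list t)) ts"

definition eps1 :: "unit pterm \<Rightarrow> nat pterm" where
  "eps1 t = label 1 t"

lemma var_list_label:
  fixes t :: "'v pterm" and ts :: "'v pterm list"
  shows "var_list (label k t) = [k ..< k + length (var_list t)]"
    and "concat (map var_list (label_list k ts)) = [k ..< k + length (concat (map var_list ts))]"
proof (induction k t and k ts rule: label_label_list.induct)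
  case (4 k t ts)
  then show ?case
    by (simp add: upt_add_eq_append[OF le_add1, symmetric] add.assoc[symmetric])
qed simp_all

lemma map_pterm_label:
  "map_pterm (\<lambda>_. ()) (label k t) = (t :: unit pterm)"
  "map (map_pterm (\<lambda>_. ())) (label_list k ts) = (ts :: unit pterm list)"
  by (induction k t and k ts rule: label_label_list.induct) simp_all

text \<open>These two facts determine \<^term>\<open>eps1 t\<close>.\<close>

lemma var_list_eps1: "var_list (eps1 t) = [1 ..< Suc (length (var_list t))]"
  by (simp add: eps1_def var_list_label)

lemma map_pterm_eps1: "map_pterm (\<lambda>_. ()) (eps1 t) = t"
  by (simp add: eps1_def map_pterm_label)


section \<open>p-ary groupoids and their fine spectra\<close>

record 'a groupoid =
  carrier :: "'a set"
  oper :: "'a list \<Rightarrow> 'a"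

definition p_groupoid :: "nat \<Rightarrow> 'a groupoid \<Rightarrow> bool" where
  "p_groupoid p G \<longleftrightarrow> carrier G \<noteq> {} \<and>
     (\<forall>as. length as = p \<and> set as \<subseteq> carrier G \<longrightarrow> oper G as \<in> carrier G)"

primrec eval_term :: "'a groupoid \<Rightarrow> ('v \<Rightarrow> 'a) \<Rightarrow> 'v pterm \<Rightarrow> 'a" where
  "eval_term G \<rho> (Var x) = \<rho> x"
| "eval_term G \<rho> (Omega ts) = oper G (map (eval_term G \<rho>) ts)"

definition satisfies :: "'a groupoid \<Rightarrow> 'v pterm \<Rightarrow> 'v pterm \<Rightarrow> bool" where
  "satisfies G s t \<longleftrightarrow>
     (\<forall>\<rho>. range \<rho> \<subseteq> carrier G \<longrightarrow> eval_term G \<rho> s = eval_term G \<rho> t)"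

definition fine_spectrum :: "nat \<Rightarrow> 'a groupoid \<Rightarrow> (unit pterm \<times> unit pterm) set" where
  "fine_spectrum p G = {(s, t) \<in> Lam p. satisfies G (eps1 s) (eps1 t)}"

definition fine_spectrum_n :: "nat \<Rightarrow> nat \<Rightarrow> 'a groupoid \<Rightarrow> (unit pterm \<times> unit pterm) set" where
  "fine_spectrum_n p n G = fine_spectrum p G \<inter> (bracketings_n p n \<times> bracketings_n p n)"

text \<open>A set cannot be defined by quantifying over types, so the groupoids here have their carriers
  inside \<^typ>\<open>nat\<close>. No fine spectrum is lost: \<open>fine_spectrum_in_FS\<close> below shows that
  the fine spectrum of a groupoid over an arbitrary type belongs to \<open>FS p\<close>.\<close>

definition FS :: "nat \<Rightarrow> (unit pterm \<times> unit pterm) set set" where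
  "FS p = {fine_spectrum p G | G :: nat groupoid. p_groupoid p G}"

definition equivs :: "'b set \<Rightarrow> ('b \<times> 'b) set set" where
  "equivs S = {r. equiv S r}"

text \<open>Covering in the poset formed by the subset \<open>L\<close> of an ordered type.\<close>

definition covers_in :: "'b::order set \<Rightarrow> 'b \<Rightarrow> 'b \<Rightarrow> bool" where
  "covers_in L a b \<longleftrightarrow> a \<in> L \<and> b \<in> L \<and> a < b \<and> \<not> (\<exists>c\<in>L. a < c \<and> c < b)"


section \<open>Every fine spectrum is realised on a countable carrier\<close>

lemma pterms_UNIV_iff:
  "Omega ts \<in> pterms p UNIV \<longleftrightarrow> length ts = p \<and> set ts \<subseteq> pterms p UNIV"
  by (subst pterms.simps) auto

lemma label_pterms:
  fixes t :: "'v pterm" and ts :: "'v pterm list"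
  shows "t \<in> pterms p UNIV \<Longrightarrow> label k t \<in> pterms p UNIV"
  "set ts \<subseteq> pterms p UNIV \<Longrightarrow>
     set (label_list k ts) \<subseteq> pterms p UNIV \<and> length (label_list k ts) = length ts"
  by (induction k t and k ts rule: label_label_list.induct)
     (auto simp: pterms_UNIV_iff intro: pterms.var)

lemma eval_term_in_carrier:
  assumes "p_groupoid p G" "range \<rho> \<subseteq> carrier G" "t \<in> pterms p UNIV"
  shows "eval_term G \<rho> t \<in> carrier G"
  using assms(3)
proof (induction rule: pterms.induct)
  case (var x)
  then show ?case using assms(2) by auto
next
  case (omega ts)
  then have "length (map (eval_term G \<rho>) ts) = p"
      "set (map (eval_term G \<rho>) ts) \<subseteq> carrier G" by auto
  then show ?case using assms(1) unfolding p_groupoid_def by simp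
qed

text \<open>An injective image of a subalgebra of G.\<close>

lemma eval_term_transfer:
  assumes closed: "\<And>as. length as = p \<Longrightarrow> set as \<subseteq> C \<Longrightarrow> oper G as \<in> C"
    and h: "inj_on h C"
    and H: "\<And>bs. oper H bs = h (oper G (map (inv_into C h) bs))"
    and r: "range \<rho> \<subseteq> C" and t: "t \<in> pterms p UNIV"
  shows "eval_term G \<rho> t \<in> C \<and> eval_term H (h \<circ> \<rho>) t = h (eval_term G \<rho> t)"
  using t
proof (induction rule: pterms.induct)
  case (var x)
  then show ?case using r by auto
next
  case (omega ts)
  have "map (inv_into C h) (map (eval_term H (h \<circ> \<rho>)) ts) = map (eval_term G \<rho>) ts"
    using omega.IH h by (simp add: comp_def)
  moreover have "oper G (map (eval_term G \<rho>) ts) \<in> C"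
    using omega.IH omega.hyps by (intro closed) auto
  ultimately show ?case by (simp only: H eval_term.simps simp_thms)
qed

theorem fine_spectrum_in_FS:
  fixes G :: "'a groupoid"
  assumes G: "p_groupoid p G"
  shows "fine_spectrum p G \<in> FS p"
proof -
  obtain a0 where a0: "a0 \<in> carrier G" using G unfolding p_groupoid_def by auto
  define w where "w st = (if satisfies G (eps1 (fst st)) (eps1 (snd st)) then (\<lambda>_. a0) else
     (SOME \<rho>. range \<rho> \<subseteq> carrier G \<and>
        eval_term G \<rho> (eps1 (fst st)) \<noteq> eval_term G \<rho> (eps1 (snd st))))"
    for st :: "unit pterm \<times> unit pterm"
  have w: "range (w st) \<subseteq> carrier G \<and> (\<not> satisfies G (eps1 (fst st)) (eps1 (snd st)) \<longrightarrow>
        eval_term G (w st) (eps1 (fst st)) \<noteq> eval_term G (w st) (eps1 (snd st)))" for st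
  proof (cases "satisfies G (eps1 (fst st)) (eps1 (snd st))")
    case True
    then show ?thesis using a0 by (auto simp: w_def)
  next
    case False
    then have ex: "\<exists>\<rho>. range \<rho> \<subseteq> carrier G \<and>
        eval_term G \<rho> (eps1 (fst st)) \<noteq> eval_term G \<rho> (eps1 (snd st))"
      unfolding satisfies_def by auto
    have "w st = (SOME \<rho>. range \<rho> \<subseteq> carrier G \<and>
        eval_term G \<rho> (eps1 (fst st)) \<noteq> eval_term G \<rho> (eps1 (snd st)))"
      using False unfolding w_def by (rule if_not_P)
    then show ?thesis using someI_ex[OF ex] by simp
  qed
  define \<rho>0 where "\<rho>0 v = w (fst v) (snd v)" for v :: "(unit pterm \<times> unit pterm) \<times> nat"
  have \<rho>0: "range \<rho>0 \<subseteq> carrier G" using w by (fastforce simp: \<rho>0_def)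
  define C where "C = eval_term G \<rho>0 ` pterms p UNIV"
  have C_sub: "C \<subseteq> carrier G" using eval_term_in_carrier[OF G \<rho>0] by (auto simp: C_def)
  have w_C: "range (w st) \<subseteq> C" for st
  proof
    fix y assume "y \<in> range (w st)"
    then obtain i where "y = w st i" by auto
    then have "y = eval_term G \<rho>0 (Var (st, i))" by (simp add: \<rho>0_def)
    then show "y \<in> C" unfolding C_def by (blast intro: pterms.var)
  qed
  then have C_ne: "C \<noteq> {}" by blast
  have closed: "oper G as \<in> C" if "length as = p" "set as \<subseteq> C" for as
  proof -
    have "\<forall>a\<in>set as. \<exists>t. t \<in> pterms p UNIV \<and> eval_term G \<rho>0 t = a"
      using that(2) by (auto simp: C_def)
    then obtain g where g: "\<forall>a\<in>set as. g a \<in> pterms p UNIV \<and> eval_term G \<rho>0 (g a) = a"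
      by metis
    have "map (eval_term G \<rho>0) (map g as) = as" using g by (simp add: map_idI)
    then have "oper G as = eval_term G \<rho>0 (Omega (map g as))"
      by (simp del: map_map)
    moreover have "Omega (map g as) \<in> pterms p UNIV"
      using that(1) g by (auto simp: pterms_UNIV_iff)
    ultimately show ?thesis unfolding C_def by blast
  qed
  have "countable C" unfolding C_def by simp
  then obtain h :: "'a \<Rightarrow> nat" where h: "inj_on h C" unfolding countable_def by auto
  define H :: "nat groupoid" where
    "H = \<lparr>carrier = h ` C, oper = (\<lambda>bs. h (oper G (map (inv_into C h) bs)))\<rparr>"
  have H_op: "oper H bs = h (oper G (map (inv_into C h) bs))" for bs by (simp add: H_def)
  have H_gr: "p_groupoid p H"
    unfolding p_groupoid_def
  proof (intro conjI allI impI)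
    show "carrier H \<noteq> {}" using C_ne by (simp add: H_def)
  next
    fix bs assume bs: "length bs = p \<and> set bs \<subseteq> carrier H"
    then have "set (map (inv_into C h) bs) \<subseteq> C"
      by (auto simp: H_def intro!: inv_into_into)
    then have "oper G (map (inv_into C h) bs) \<in> C" using bs by (intro closed) auto
    then show "oper H bs \<in> carrier H" by (simp add: H_def)
  qed
  have eps: "eps1 t \<in> pterms p UNIV" if "t \<in> bracketings p" for t
    using that label_pterms(1) by (auto simp: eps1_def bracketings_def)
  have "satisfies H (eps1 s) (eps1 t) \<longleftrightarrow> satisfies G (eps1 s) (eps1 t)"
    if s: "s \<in> bracketings p" and t: "t \<in> bracketings p" for s t
  proof
    assume L: "satisfies G (eps1 s) (eps1 t)"
    show "satisfies H (eps1 s) (eps1 t)"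
      unfolding satisfies_def
    proof (intro allI impI)
      fix \<rho> :: "nat \<Rightarrow> nat" assume r: "range \<rho> \<subseteq> carrier H"
      define \<rho>' where "\<rho>' = inv_into C h \<circ> \<rho>"
      have r': "range \<rho>' \<subseteq> C"
        using r by (auto simp: H_def \<rho>'_def intro!: inv_into_into)
      have "\<rho> = h \<circ> \<rho>'"
      proof
        fix i show "\<rho> i = (h \<circ> \<rho>') i"
          using r by (auto simp: H_def \<rho>'_def f_inv_into_f image_subset_iff)
      qed
      moreover have "eval_term G \<rho>' (eps1 s) = eval_term G \<rho>' (eps1 t)"
        using L r' C_sub unfolding satisfies_def by blast
      ultimately show "eval_term H \<rho> (eps1 s) = eval_term H \<rho> (eps1 t)"
        using eval_term_transfer[OF closed h H_op r' eps[OF s]]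
          eval_term_transfer[OF closed h H_op r' eps[OF t]] by simp
    qed
  next
    assume R: "satisfies H (eps1 s) (eps1 t)"
    let ?r = "w (s, t)"
    have S: "eval_term G ?r (eps1 s) \<in> C \<and>
        eval_term H (h \<circ> ?r) (eps1 s) = h (eval_term G ?r (eps1 s))"
      by (rule eval_term_transfer[OF closed h H_op w_C eps[OF s]])
    have T: "eval_term G ?r (eps1 t) \<in> C \<and>
        eval_term H (h \<circ> ?r) (eps1 t) = h (eval_term G ?r (eps1 t))"
      by (rule eval_term_transfer[OF closed h H_op w_C eps[OF t]])
    have "range (h \<circ> ?r) \<subseteq> carrier H" using w_C[of "(s, t)"] by (auto simp: H_def)
    then have "eval_term H (h \<circ> ?r) (eps1 s) = eval_term H (h \<circ> ?r) (eps1 t)"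
      using R unfolding satisfies_def by blast
    then have "eval_term G ?r (eps1 s) = eval_term G ?r (eps1 t)"
      using S T h by (metis inj_onD)
    then show "satisfies G (eps1 s) (eps1 t)" using w[of "(s, t)"] by auto
  qed
  then have "fine_spectrum p H = fine_spectrum p G"
    unfolding fine_spectrum_def Lam_def by auto
  then show ?thesis unfolding FS_def using H_gr by blast
qed

end

(* Fine spectra are exactly the level-preserving equivalence relations on bracketings that are
   compatible with omega and stable under simultaneous substitution for the leaves: such a relation R
   is the fine spectrum of the quotient of the bracketings by R.  Both closure operations either fix a
   pair or move it to a strictly higher level.  Hence, if a and b are fine spectra with a below b, then
   for every n and every equivalence relation theta between the n-th levels of a and b, taking a below
   level n, theta on level n and b above level n again gives a fine spectrum.  If a is covered by b,
   this intermediate spectrum must be a or b. *)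

theory Submission
  imports Defs
begin

section \<open>Substitution\<close>

primrec psubst :: "('v \<Rightarrow> 'w pterm) \<Rightarrow> 'v pterm \<Rightarrow> 'w pterm" where
  "psubst u (Var x) = u x"
| "psubst u (Omega ts) = Omega (map (psubst u) ts)"

lemma psubst_pterms:
  assumes "t \<in> pterms p X" "\<And>x. x \<in> X \<Longrightarrow> u x \<in> pterms p Y"
  shows "psubst u t \<in> pterms p Y"
  using assms by (induction rule: pterms.induct) (auto intro!: pterms.omega)

lemma eval_term_psubst: "eval_term G \<rho> (psubst u t) = eval_term G (\<lambda>x. eval_term G \<rho> (u x)) t"
  by (induction t) (auto simp: comp_def cong: map_cong)

lemma eval_term_map_pterm: "eval_term G \<rho> (map_pterm f t) = eval_term G (\<rho> \<circ> f) t"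
  by (induction t) (auto simp: comp_def cong: map_cong)

lemma var_list_psubst: "var_list (psubst u t) = concat (map (\<lambda>x. var_list (u x)) (var_list t))"
proof (induction t)
  case (Omega ts)
  then show ?case by (induction ts) auto
qed simp

section \<open>Counting omegas in labelled terms and substitution instances\<close>

lemma num_omega_label:
  fixes t :: "'v pterm" and ts :: "'v pterm list"
  shows
  "num_omega (label k t) = num_omega t"
  "sum_list (map num_omega (label_list k ts)) = sum_list (map num_omega ts)"
  by (induction k t and k ts rule: label_label_list.induct) auto

lemma num_omega_psubst:
  "num_omega (psubst u t) = num_omega t + (\<Sum>x\<leftarrow>var_list t. num_omega (u x))"
proof (induction t)
  case (Omega ts)
  then show ?case by (induction ts) auto
qed simp

text \<open>By \<open>num_omega_psubst\<close>, equality of the two counts forces every term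
  substituted for an occurring variable to be free of omega, and over the one-element variable type
  the only such term is \<open>Var ()\<close>.\<close>

lemma psubst_eq_map_pterm:
  fixes u :: "'v \<Rightarrow> unit pterm"
  assumes "num_omega (psubst u t) = num_omega t"
  shows "psubst u t = map_pterm (\<lambda>_. ()) t"
proof -
  have "u x = Var ()" if "x \<in> set (var_list t)" for x
    using assms that by (cases "u x") (auto simp: num_omega_psubst)
  then show ?thesis by (induction t) auto
qed

lemma num_omega_psubst_eps1_ge: "num_omega t \<le> num_omega (psubst u (eps1 t))"
  by (simp add: num_omega_psubst eps1_def num_omega_label)

text \<open>Together with \<open>num_omega_psubst_eps1_ge\<close> this gives the dichotomy behind
  the gluing: substituting for the leaves either leaves a bracketing unchanged or strictly raises
  its level.\<close>

lemma psubst_eps1_same_level: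
  "num_omega (psubst u (eps1 t)) = num_omega t \<Longrightarrow> psubst u (eps1 t) = (t :: unit pterm)"
  using psubst_eq_map_pterm[of u "eps1 t"]
  by (simp add: eps1_def num_omega_label map_pterm_label)

section \<open>Labelling of leaves and its interaction with substitution\<close>

lemma label_add:
  fixes t :: "'v pterm" and ts :: "'v pterm list"
  shows
  "label (k + j) t = map_pterm (\<lambda>i. i + j) (label k t)"
  "label_list (k + j) ts = map (map_pterm (\<lambda>i. i + j)) (label_list k ts)"
proof (induction k t and k ts rule: label_label_list.induct)
  case (4 k t ts)
  then show ?case by (simp add: ac_simps)
qed auto

text \<open>Substituting \<open>u i\<close> for the variable \<open>i\<close> moves the first leaf of that copy of \<open>u i\<close> to
  position \<open>off i\<close>.\<close>

lemma label_psubst_label: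
  fixes t :: "'v pterm" and ts :: "'v pterm list"
  assumes off: "\<And>i. m \<le> i \<Longrightarrow> off (Suc i) = off i + length (var_list (u i))"
  shows "m \<le> k \<Longrightarrow>
      label (off k) (psubst u (label k t)) = psubst (\<lambda>i. label (off i) (u i)) (label k t)"
    and "m \<le> k \<Longrightarrow> label_list (off k) (map (psubst u) (label_list k ts)) =
      map (psubst (\<lambda>i. label (off i) (u i))) (label_list k ts)"
proof (induction k t and k ts rule: label_label_list.induct)
  case (4 k t ts)
  \<comment> \<open>By telescoping, the copies substituted for the \<open>l\<close> variables
    starting at \<open>k\<close> occupy the positions from \<open>off k\<close> up to but excluding
    \<open>off (k + l)\<close>. With \<open>l\<close> the leaf count of \<open>t\<close>, this is
    where labelling of the remaining list begins.\<close>
  have "off k + length (concat (map (\<lambda>i. var_list (u i)) [k..<k + l])) = off (k + l)" for l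
    using 4(3) by (induction l) (simp_all add: off)
  then have "off k + length (var_list (psubst u (label k t))) = off (k + length (var_list t))"
    by (simp add: var_list_psubst var_list_label)
  with 4 show ?case by simp
qed simp_all

text \<open>This is the leaf count (p - 1) n + 1 of a p-ary tree with n inner nodes, written without
  subtraction. It shows that bracketings on one level have equally many leaves, so their
  \<open>eps1\<close> versions use the same variables.\<close>

lemma length_var_list:
  assumes "t \<in> pterms p X"
  shows "length (var_list t) + num_omega t = Suc (p * num_omega t)"
  using assms
proof (induction rule: pterms.induct)
  case (omega ts)
  have "length (concat (map var_list ts)) + sum_list (map num_omega ts) =
      length ts + p * sum_list (map num_omega ts)"
    using omega.IH by (induction ts) (auto simp: algebra_simps)
  with omega.hyps show ?case by simp
qed simp


section \<open>Fine spectra as congruences on bracketings\<close>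

text \<open>As \<open>eps1\<close> makes the leaves distinct, \<open>psubst u (eps1 s)\<close>
  grafts \<open>u i\<close> onto the \<open>i\<close>-th leaf of \<open>s\<close>, counted from 1,
  with no relation required between the grafted terms.\<close>

definition bracketing_congruence :: "nat \<Rightarrow> (unit pterm \<times> unit pterm) set \<Rightarrow> bool" where
  "bracketing_congruence p R \<longleftrightarrow> equiv (bracketings p) R \<and> R \<subseteq> Lam p \<and>
     (\<forall>ss ts. length ss = p \<longrightarrow> list_all2 (\<lambda>s t. (s, t) \<in> R) ss ts \<longrightarrow> (Omega ss, Omega ts) \<in> R) \<and>
     (\<forall>s t u. (s, t) \<in> R \<longrightarrow> range u \<subseteq> bracketings p \<longrightarrow>
        (psubst u (eps1 s), psubst u (eps1 t)) \<in> R)"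

section \<open>Fine spectra are bracketing congruences\<close>

lemma satisfies_label:
  assumes "satisfies G (eps1 s) (eps1 t)" "range \<rho> \<subseteq> carrier G"
  shows "eval_term G \<rho> (label (Suc j) s) = eval_term G \<rho> (label (Suc j) t)"
proof -
  have *: "eval_term G \<rho> (label (Suc j) r) = eval_term G (\<rho> \<circ> (\<lambda>i. i + j)) (eps1 r)" for r
    using label_add(1)[of 1 j r] by (simp add: eval_term_map_pterm eps1_def)
  have "range (\<rho> \<circ> (\<lambda>i. i + j)) \<subseteq> carrier G" using assms(2) by auto
  with assms(1) show ?thesis unfolding * satisfies_def by blast
qed

text \<open>Equal leaf counts keep the labels of both lists in step, so corresponding arguments
  start at the same label. The shift of that label is absorbed into the valuation by
  \<open>satisfies_label\<close>.\<close>

lemma satisfies_label_list: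
  assumes "list_all2 (\<lambda>s t. satisfies G (eps1 s) (eps1 t) \<and>
      length (var_list s) = length (var_list t)) ss ts" "range \<rho> \<subseteq> carrier G"
  shows "map (eval_term G \<rho>) (label_list (Suc j) ss) = map (eval_term G \<rho>) (label_list (Suc j) ts)"
  using assms(1)
proof (induction arbitrary: j rule: list_all2_induct)
  case (Cons s ss t ts)
  then show ?case using satisfies_label[OF _ assms(2)] by simp
qed simp

lemma bracketings_Omega: "Omega ts \<in> bracketings p \<longleftrightarrow> length ts = p \<and> set ts \<subseteq> bracketings p"
  by (simp add: bracketings_def pterms_UNIV_iff)

lemma psubst_eps1_bracketings:
  assumes "t \<in> bracketings p" "range u \<subseteq> bracketings p"
  shows "psubst u (eps1 t) \<in> bracketings p"
  using assms label_pterms(1)[of t p 1] unfolding bracketings_def eps1_def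
  by (intro psubst_pterms[where X = UNIV]) auto

lemma length_var_list_Lam: "(s, t) \<in> Lam p \<Longrightarrow> length (var_list s) = length (var_list t)"
  using length_var_list[of s p UNIV] length_var_list[of t p UNIV]
  by (auto simp: Lam_def bracketings_def)

lemma fine_spectrum_Omega:
  assumes "length ss = p" and st: "list_all2 (\<lambda>s t. (s, t) \<in> fine_spectrum p G) ss ts"
  shows "(Omega ss, Omega ts) \<in> fine_spectrum p G"
proof -
  have "list_all2 (\<lambda>s t. satisfies G (eps1 s) (eps1 t) \<and>
      length (var_list s) = length (var_list t)) ss ts"
    using st by (rule list_all2_mono) (auto simp: fine_spectrum_def dest: length_var_list_Lam)
  then have "satisfies G (eps1 (Omega ss)) (eps1 (Omega ts))"
    using satisfies_label_list[of G ss ts _ 0] by (simp add: satisfies_def eps1_def)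
  moreover have "set ss \<subseteq> bracketings p \<and> set ts \<subseteq> bracketings p \<and>
      sum_list (map num_omega ss) = sum_list (map num_omega ts)"
    using st by (induction rule: list_all2_induct) (auto simp: fine_spectrum_def Lam_def)
  ultimately show ?thesis
    using assms by (auto simp: fine_spectrum_def Lam_def bracketings_Omega dest: list_all2_lengthD)
qed

lemma fine_spectrum_psubst:
  assumes G: "p_groupoid p G" and st: "(s, t) \<in> fine_spectrum p G" and u: "range u \<subseteq> bracketings p"
  shows "(psubst u (eps1 s), psubst u (eps1 t)) \<in> fine_spectrum p G"
proof -
  have lam: "(s, t) \<in> Lam p" and sat: "satisfies G (eps1 s) (eps1 t)"
    using st by (auto simp: fine_spectrum_def)
  then have "(psubst u (eps1 s), psubst u (eps1 t)) \<in> Lam p"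
    using psubst_eps1_bracketings[OF _ u] length_var_list_Lam[OF lam]
    by (auto simp: Lam_def num_omega_psubst eps1_def num_omega_label var_list_label)
  moreover have "satisfies G (eps1 (psubst u (eps1 s))) (eps1 (psubst u (eps1 t)))"
    unfolding satisfies_def
  proof (intro allI impI)
    fix \<rho> :: "nat \<Rightarrow> 'a" assume \<rho>: "range \<rho> \<subseteq> carrier G"
    \<comment> \<open>\<open>off i\<close> is the first label used in the copy of \<open>u i\<close>
      when the whole instance is labelled from 1. It depends on \<open>u\<close> alone, so one
      valuation \<open>\<rho>'\<close> turns the identity for the instances of \<open>s\<close> and
      \<open>t\<close> into \<open>eps1 s \<approx> eps1 t\<close>.\<close>
    define off where "off i = Suc (\<Sum>j\<in>{1..<i}. length (var_list (u j)))" for i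
    define \<rho>' where "\<rho>' i = eval_term G \<rho> (label (off i) (u i))" for i
    have "label (off 1) (psubst u (label 1 r)) = psubst (\<lambda>i. label (off i) (u i)) (label 1 r)"
      for r :: "unit pterm"
      by (rule label_psubst_label(1)[where m = 1]) (auto simp: off_def)
    then have *: "eval_term G \<rho> (eps1 (psubst u (eps1 r))) = eval_term G \<rho>' (eps1 r)"
      for r :: "unit pterm"
      by (simp add: eps1_def off_def eval_term_psubst \<rho>'_def[abs_def])
    have "range \<rho>' \<subseteq> carrier G"
      using u by (auto simp: \<rho>'_def bracketings_def
          intro!: eval_term_in_carrier[OF G \<rho>] label_pterms(1))
    with sat show "eval_term G \<rho> (eps1 (psubst u (eps1 s))) = eval_term G \<rho> (eps1 (psubst u (eps1 t)))"
      unfolding * satisfies_def by blast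
  qed
  ultimately show ?thesis by (simp add: fine_spectrum_def)
qed

lemma bracketing_congruence_fine_spectrum:
  assumes "p_groupoid p G"
  shows "bracketing_congruence p (fine_spectrum p G)"
proof -
  have "equiv (bracketings p) (fine_spectrum p G)"
    by (rule equivI) (auto simp: refl_on_def sym_def trans_def fine_spectrum_def Lam_def satisfies_def)
  with assms show ?thesis
    unfolding bracketing_congruence_def
    by (auto intro: fine_spectrum_Omega fine_spectrum_psubst) (auto simp: fine_spectrum_def)
qed

section \<open>Every bracketing congruence is a fine spectrum\<close>

text \<open>The quotient of the bracketings by \<open>R\<close> is represented on a set of class representatives.\<close>

lemma bracketing_congruence_in_FS:
  assumes "bracketing_congruence p R"
  shows "R \<in> FS p"
proof -
  have eq: "equiv (bracketings p) R" and lam: "R \<subseteq> Lam p"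
    and cong: "\<And>ss ts. length ss = p \<Longrightarrow> list_all2 (\<lambda>s t. (s, t) \<in> R) ss ts \<Longrightarrow> (Omega ss, Omega ts) \<in> R"
    and sub: "\<And>s t u. (s, t) \<in> R \<Longrightarrow> range u \<subseteq> bracketings p \<Longrightarrow>
        (psubst u (eps1 s), psubst u (eps1 t)) \<in> R"
    using assms unfolding bracketing_congruence_def by blast+
  have refl: "(t, t) \<in> R" if "t \<in> bracketings p" for t
    using eq that by (meson equivE refl_onD)
  have sym: "(t, s) \<in> R" if "(s, t) \<in> R" for s t
    using eq that by (meson equivE symD)
  have tr: "(s, r) \<in> R" if "(s, t) \<in> R" "(t, r) \<in> R" for s t r
    using eq that by (meson equivE transD)
  define rep where "rep t = (SOME s. (t, s) \<in> R)" for t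
  have rep: "(t, rep t) \<in> R" if "t \<in> bracketings p" for t
    unfolding rep_def using refl[OF that] by (rule someI)
  have rep_in: "rep t \<in> bracketings p" if "t \<in> bracketings p" for t
    using rep[OF that] lam by (auto simp: Lam_def)
  have rep_cong: "rep s = rep t" if "(s, t) \<in> R" for s t
  proof -
    have "(\<lambda>r. (s, r) \<in> R) = (\<lambda>r. (t, r) \<in> R)" using that sym tr by blast
    then show ?thesis by (simp add: rep_def)
  qed
  have rep_iff: "rep s = rep t \<longleftrightarrow> (s, t) \<in> R" if "s \<in> bracketings p" "t \<in> bracketings p" for s t
    using that rep sym tr rep_cong by metis
  \<comment> \<open>The quotient operation: build the compound term from representatives, then pass
    to the representative of its class.\<close>
  define G where "G = \<lparr>carrier = rep ` bracketings p, oper = (\<lambda>ts. rep (Omega ts))\<rparr>"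
  have sub_carrier: "carrier G \<subseteq> bracketings p" using rep_in by (auto simp: G_def)
  have "Var () \<in> bracketings p" by (simp add: bracketings_def pterms.var)
  then have G: "p_groupoid p G"
    using sub_carrier unfolding p_groupoid_def by (auto simp: G_def bracketings_Omega)
  \<comment> \<open>Evaluation in the quotient is substitution followed by normalisation. Closure of
    \<open>R\<close> under \<open>Omega\<close> lets the arguments be normalised before the whole
    term.\<close>
  have eval: "eval_term G \<rho> t = rep (psubst \<rho> t)"
    if \<rho>: "range \<rho> \<subseteq> carrier G" and "t \<in> pterms p UNIV" for \<rho> :: "nat \<Rightarrow> unit pterm" and t
    using that(2)
  proof (induction rule: pterms.induct)
    case (var x)
    have "\<rho> x \<in> rep ` bracketings p" using \<rho> by (auto simp: G_def)
    then show ?case using rep rep_cong by fastforce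
  next
    case (omega ts)
    have "psubst \<rho> t \<in> bracketings p" if "t \<in> set ts" for t
      using omega.hyps(2)[OF that] \<rho> sub_carrier psubst_pterms[of t p UNIV \<rho> UNIV]
      by (auto simp: bracketings_def)
    then have "(Omega (map (psubst \<rho>) ts), Omega (map (\<lambda>t. rep (psubst \<rho> t)) ts)) \<in> R"
      using omega.hyps(1) rep by (intro cong) (auto simp: list_all2_conv_all_nth)
    then have "rep (Omega (map (\<lambda>t. rep (psubst \<rho> t)) ts)) = rep (Omega (map (psubst \<rho>) ts))"
      using rep_cong by metis
    moreover have "map (eval_term G \<rho>) ts = map (\<lambda>t. rep (psubst \<rho> t)) ts"
      using omega.IH by simp
    ultimately show ?case by (simp add: G_def del: map_eq_conv)
  qed
  have eps: "eps1 t \<in> pterms p UNIV" if "t \<in> bracketings p" for t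
    using that label_pterms(1) by (auto simp: eps1_def bracketings_def)
  have "satisfies G (eps1 s) (eps1 t) \<longleftrightarrow> (s, t) \<in> R"
    if s: "s \<in> bracketings p" and t: "t \<in> bracketings p" for s t
  proof
    assume "(s, t) \<in> R"
    then show "satisfies G (eps1 s) (eps1 t)"
      using sub sub_carrier eval[OF _ eps[OF s]] eval[OF _ eps[OF t]] rep_cong
      unfolding satisfies_def by (metis order_trans)
  next
    assume sat: "satisfies G (eps1 s) (eps1 t)"
    \<comment> \<open>The separating valuation sends each variable to the class of the one-leaf
      bracketing. Since \<open>R\<close> preserves levels, its representative contains no omega, so
      evaluating \<open>eps1 r\<close> returns just \<open>rep r\<close>.\<close>
    let ?\<rho> = "\<lambda>_::nat. rep (Var ())"
    have "num_omega (rep (Var ())) = num_omega (Var ())"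
      using rep \<open>Var () \<in> bracketings p\<close> lam by (fastforce simp: Lam_def)
    then have id: "psubst ?\<rho> (eps1 r) = r" for r
      by (intro psubst_eps1_same_level) (simp add: num_omega_psubst eps1_def num_omega_label)
    have "range ?\<rho> \<subseteq> carrier G" using \<open>Var () \<in> bracketings p\<close> by (auto simp: G_def)
    then have "rep s = rep t"
      using sat eval[OF _ eps[OF s], of ?\<rho>] eval[OF _ eps[OF t], of ?\<rho>]
      unfolding satisfies_def id by auto
    then show "(s, t) \<in> R" using s t rep_iff by blast
  qed
  then have "fine_spectrum p G = R"
    using lam unfolding fine_spectrum_def Lam_def by auto
  \<comment> \<open>The carrier of \<open>G\<close> consists of terms; its spectrum has to be
    realised again on natural numbers.\<close>
  then show ?thesis using fine_spectrum_in_FS[OF G] by simp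
qed

lemma FS_iff: "R \<in> FS p \<longleftrightarrow> bracketing_congruence p R"
  using bracketing_congruence_fine_spectrum bracketing_congruence_in_FS by (auto simp: FS_def)


section \<open>Gluing fine spectra along levels\<close>

text \<open>With the two inclusions, \<open>low\<close> and \<open>high\<close> make
  \<open>R\<close> equal to \<open>A\<close> below level \<open>n\<close> and to \<open>B\<close>
  above it. On level \<open>n\<close> itself it may be any equivalence between them.\<close>

lemma glue_in_FS:
  assumes A: "A \<in> FS p" and B: "B \<in> FS p" and eq: "equiv (bracketings p) R"
    and AR: "A \<subseteq> R" and RB: "R \<subseteq> B"
    and low: "\<And>s t. (s, t) \<in> R \<Longrightarrow> num_omega s < n \<Longrightarrow> (s, t) \<in> A"
    and high: "\<And>s t. (s, t) \<in> B \<Longrightarrow> n < num_omega s \<Longrightarrow> (s, t) \<in> R"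
  shows "R \<in> FS p"
proof -
  note A = A[unfolded FS_iff bracketing_congruence_def]
    and B = B[unfolded FS_iff bracketing_congruence_def]
  have lam: "R \<subseteq> Lam p" using RB B by blast
  have "(Omega ss, Omega ts) \<in> R"
    if len: "length ss = p" and st: "list_all2 (\<lambda>s t. (s, t) \<in> R) ss ts" for ss ts
  \<comment> \<open>Arguments lie strictly below the level of the compound term. If that level is at
    most \<open>n\<close>, they are related by \<open>A\<close>, whose closure applies; otherwise
    closure of \<open>B\<close> suffices, because the result is above \<open>n\<close>.\<close>
  proof (cases "num_omega (Omega ss) \<le> n")
    case True
    have "num_omega s < n" if "s \<in> set ss" for s
      using True member_le_sum_list[of "num_omega s" "map num_omega ss"] that by auto
    then have "list_all2 (\<lambda>s t. (s, t) \<in> A) ss ts"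
      using st low by (auto simp: list_all2_conv_all_nth)
    then show ?thesis using A AR len by blast
  next
    case False
    have "list_all2 (\<lambda>s t. (s, t) \<in> B) ss ts"
      using st RB by (auto simp: list_all2_conv_all_nth)
    then have "(Omega ss, Omega ts) \<in> B" using B len by blast
    then show ?thesis using False high by simp
  qed
  moreover have "(psubst u (eps1 s), psubst u (eps1 t)) \<in> R"
    if st: "(s, t) \<in> R" and u: "range u \<subseteq> bracketings p" for s t u
  proof -
    have B': "(psubst u (eps1 s), psubst u (eps1 t)) \<in> B"
      using st RB B u by blast
    \<comment> \<open>If the level is kept, the instance is the pair itself. If it rises, a pair
      from below \<open>n\<close> is handled by closure of \<open>A\<close>, and a pair from level
      \<open>n\<close> or higher lands above \<open>n\<close>, where \<open>R\<close> contains
      \<open>B\<close>.\<close>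
    show ?thesis
    proof (cases "num_omega (psubst u (eps1 s)) = num_omega s")
      case True
      moreover have "num_omega (psubst u (eps1 t)) = num_omega (psubst u (eps1 s))"
        "num_omega s = num_omega t"
        using B' B st lam by (auto simp: Lam_def)
      ultimately show ?thesis using st by (simp add: psubst_eps1_same_level)
    next
      case False
      then have less: "num_omega s < num_omega (psubst u (eps1 s))"
        using num_omega_psubst_eps1_ge[of s u] by simp
      show ?thesis
      proof (cases "num_omega s < n")
        case True
        then show ?thesis using low st A AR u by blast
      next
        case False
        then show ?thesis using less high B' by simp
      qed
    qed
  qed
  ultimately show ?thesis using eq lam unfolding FS_iff bracketing_congruence_def by blast
qed

section \<open>Levels of a relation and spectra with one prescribed level\<close>

definition level :: "nat \<Rightarrow> nat \<Rightarrow> (unit pterm \<times> unit pterm) set \<Rightarrow> (unit pterm \<times> unit pterm) set" where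
  "level p n R = R \<inter> bracketings_n p n \<times> bracketings_n p n"

lemma level_mono: "R \<subseteq> S \<Longrightarrow> level p n R \<subseteq> level p n S"
  by (auto simp: level_def)

lemma FS_subset_Lam: "R \<in> FS p \<Longrightarrow> R \<subseteq> Lam p"
  by (simp add: FS_iff bracketing_congruence_def)

text \<open>A relation inside \<open>Lam p\<close> is the union of its levels, so inclusion can be
  tested level by level.\<close>

lemma Lam_level_subset:
  assumes "R \<subseteq> Lam p" "\<And>n. level p n R \<subseteq> level p n S"
  shows "R \<subseteq> S"
proof clarify
  fix s t assume "(s, t) \<in> R"
  then have "(s, t) \<in> level p (num_omega s) R"
    using assms(1) by (auto simp: level_def bracketings_n_def Lam_def)
  then show "(s, t) \<in> S" using assms(2) by (auto simp: level_def)
qed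

lemma level_equiv:
  assumes "R \<in> FS p"
  shows "equiv (bracketings_n p n) (level p n R)"
proof -
  have "equiv (bracketings p) R" using assms by (simp add: FS_iff bracketing_congruence_def)
  then have "refl_on (bracketings p) R" and "sym R" "trans R" by (auto elim: equivE)
  have "refl_on (bracketings_n p n) (level p n R)"
    using \<open>refl_on (bracketings p) R\<close>
    by (intro refl_onI) (auto simp: level_def bracketings_n_def dest: refl_onD)
  moreover have "sym (level p n R)"
    using \<open>sym R\<close> by (intro symI) (auto simp: level_def dest: symD)
  moreover have "trans (level p n R)"
    using \<open>trans R\<close> by (simp add: level_def trans_Restr)
  ultimately show ?thesis by (intro equivI) (auto simp: level_def)
qed

text \<open>One level can be prescribed freely between those of \<open>A\<close> and
  \<open>B\<close>; in exchange, all higher levels of the constructed spectrum are those of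
  \<open>B\<close>.\<close>

lemma interpolating_spectrum:
  assumes A: "A \<in> FS p" and B: "B \<in> FS p" and "A \<subseteq> B"
    and E: "equiv (bracketings_n p n) E" and AE: "level p n A \<subseteq> E" and EB: "E \<subseteq> level p n B"
  obtains R where "R \<in> FS p" "A \<subseteq> R" "R \<subseteq> B" "level p n R = E"
    "\<forall>m>n. level p m R = level p m B"
proof -
  define R where "R = {(s, t) \<in> B. (num_omega s < n \<longrightarrow> (s, t) \<in> A) \<and>
      (num_omega s = n \<longrightarrow> (s, t) \<in> E)}"
  have eqA: "equiv (bracketings p) A" and eqB: "equiv (bracketings p) B"
    and lamB: "B \<subseteq> Lam p"
    using A B by (auto simp: FS_iff bracketing_congruence_def)
  have num: "num_omega s = num_omega t \<and> s \<in> bracketings p \<and> t \<in> bracketings p" if "(s, t) \<in> B" for s t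
    using lamB that by (auto simp: Lam_def)
  have eq: "equiv (bracketings p) R"
  proof (rule equivI)
    show "R \<subseteq> bracketings p \<times> bracketings p" using num by (auto simp: R_def)
    show "refl_on (bracketings p) R"
    proof (rule refl_onI)
      fix t assume t: "t \<in> bracketings p"
      have "(t, t) \<in> A" "(t, t) \<in> B" using t eqA eqB by (meson equivE refl_onD)+
      moreover have "num_omega t = n \<longrightarrow> (t, t) \<in> E"
        using E t by (auto simp: bracketings_n_def elim!: equivE dest: refl_onD)
      ultimately show "(t, t) \<in> R" by (simp add: R_def)
    qed
    have syms: "sym A" "sym B" "sym E" and transs: "trans A" "trans B" "trans E"
      using eqA eqB E by (auto elim: equivE)
    show "sym R"
      using num by (auto intro!: symI simp: R_def dest: symD[OF syms(1)] symD[OF syms(2)] symD[OF syms(3)])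
    show "trans R"
    proof (rule transI)
      fix s t r assume st: "(s, t) \<in> R" and tr: "(t, r) \<in> R"
      \<comment> \<open>Both pairs lie on the same level, so they fall under the same case of the
        definition of \<open>R\<close>.\<close>
      then have "num_omega s = num_omega t" using num by (auto simp: R_def)
      with st tr show "(s, r) \<in> R"
        by (auto simp: R_def intro: transD[OF transs(1)] transD[OF transs(2)] transD[OF transs(3)])
    qed
  qed
  have AR: "A \<subseteq> R"
  proof clarify
    fix s t assume "(s, t) \<in> A"
    moreover from this have "(s, t) \<in> B" using \<open>A \<subseteq> B\<close> by blast
    moreover from this have "num_omega s = n \<Longrightarrow> (s, t) \<in> level p n A"
      using num \<open>(s, t) \<in> A\<close> by (auto simp: level_def bracketings_n_def)
    ultimately show "(s, t) \<in> R" using AE by (auto simp: R_def)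
  qed
  have RB: "R \<subseteq> B" by (auto simp: R_def)
  have "R \<in> FS p"
    by (rule glue_in_FS[OF A B eq AR RB, of n]) (auto simp: R_def)
  moreover have "level p n R = E"
  proof
    show "level p n R \<subseteq> E" by (auto simp: R_def level_def bracketings_n_def)
    show "E \<subseteq> level p n R" using EB by (auto simp: R_def level_def bracketings_n_def)
  qed
  moreover have "\<forall>m>n. level p m R = level p m B"
    by (auto simp: R_def level_def bracketings_n_def)
  ultimately show thesis using that AR RB by blast
qed

section \<open>Coverings of fine spectra compared level by level\<close>

lemma covers_in_FS_iff:
  assumes A: "A \<in> FS p" and B: "B \<in> FS p"
  shows "covers_in (FS p) A B \<longleftrightarrow>
    (\<exists>!n. level p n A \<noteq> level p n B) \<and>
    (\<forall>n. level p n A \<noteq> level p n B \<longrightarrow>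
       covers_in (equivs (bracketings_n p n)) (level p n A) (level p n B))"
    (is "?L \<longleftrightarrow> ?R")
proof
  assume L: ?L
  then have AB: "A \<subset> B" by (simp add: covers_in_def)
  then have sub: "A \<subseteq> B" by blast
  have between: "R = A \<or> R = B" if "R \<in> FS p" "A \<subseteq> R" "R \<subseteq> B" for R
    using L that by (auto simp: covers_in_def psubset_eq)
  obtain n where n: "level p n A \<noteq> level p n B"
    using Lam_level_subset[OF FS_subset_Lam[OF B], of A] AB by fastforce
  \<comment> \<open>For two differing levels \<open>i < j\<close>, interpolate at \<open>i\<close>
    with the level of \<open>A\<close>. The result differs from \<open>B\<close> on level
    \<open>i\<close> and, agreeing with \<open>B\<close> on level \<open>j\<close>, also differs
    from \<open>A\<close>.\<close>
  have not_less: "\<not> i < j" if "level p i A \<noteq> level p i B" "level p j A \<noteq> level p j B" for i j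
  proof
    assume "i < j"
    moreover obtain R where "R \<in> FS p" "A \<subseteq> R" "R \<subseteq> B" "level p i R = level p i A"
      "\<forall>m>i. level p m R = level p m B"
      using interpolating_spectrum[OF A B sub level_equiv[OF A] order_refl level_mono[OF sub]] by blast
    ultimately show False using between[of R] that by metis
  qed
  moreover have "covers_in (equivs (bracketings_n p n)) (level p n A) (level p n B)"
    if n: "level p n A \<noteq> level p n B" for n
    unfolding covers_in_def
  proof (intro conjI notI)
    show "level p n A \<in> equivs (bracketings_n p n)" "level p n B \<in> equivs (bracketings_n p n)"
      using A B by (simp_all add: equivs_def level_equiv)
    show "level p n A \<subset> level p n B" using n level_mono[OF sub] by blast
    assume "\<exists>E\<in>equivs (bracketings_n p n). level p n A \<subset> E \<and> E \<subset> level p n B"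
    then obtain E where E: "equiv (bracketings_n p n) E" "level p n A \<subset> E" "E \<subset> level p n B"
      by (auto simp: equivs_def)
    then obtain R where "R \<in> FS p" "A \<subseteq> R" "R \<subseteq> B" "level p n R = E"
      using interpolating_spectrum[OF A B sub E(1)] by blast
    then show False using between E by blast
  qed
  ultimately show ?R using n by (metis nat_neq_iff)
next
  assume R: ?R
  then obtain n where n: "level p n A \<noteq> level p n B"
    and uniq: "\<And>m. m \<noteq> n \<Longrightarrow> level p m A = level p m B" by metis
  from R n have cov: "covers_in (equivs (bracketings_n p n)) (level p n A) (level p n B)" by blast
  have "level p m A \<subseteq> level p m B" for m
    using cov uniq by (cases "m = n") (auto simp: covers_in_def)
  then have sub: "A \<subseteq> B" by (rule Lam_level_subset[OF FS_subset_Lam[OF A]])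
  have False if C: "C \<in> FS p" "A \<subset> C" "C \<subset> B" for C
  proof -
    have mono: "level p m A \<subseteq> level p m C" "level p m C \<subseteq> level p m B" for m
      using C by (simp_all add: level_mono)
    have "level p n C \<in> equivs (bracketings_n p n)" by (simp add: equivs_def level_equiv C)
    then have "level p n C = level p n A \<or> level p n C = level p n B"
      using cov mono[of n] by (auto simp: covers_in_def psubset_eq)
    \<comment> \<open>Away from \<open>n\<close> the levels of \<open>A\<close> and \<open>B\<close>
      coincide and squeeze that of \<open>C\<close>, so level \<open>n\<close> alone decides which
      end \<open>C\<close> equals.\<close>
    then have "(\<forall>m. level p m C \<subseteq> level p m A) \<or> (\<forall>m. level p m B \<subseteq> level p m C)"
      using uniq mono by (metis order_refl)
    then have "C \<subseteq> A \<or> B \<subseteq> C"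
      using Lam_level_subset FS_subset_Lam B C(1) by metis
    then show False using C by blast
  qed
  with sub n A B show ?L by (auto simp: covers_in_def)
qed

theorem proposition6p1:
  fixes p :: nat and G :: "'a groupoid" and H :: "'b groupoid"
  assumes "p \<ge> 2"
    and "p_groupoid p G"
    and "p_groupoid p H"
  shows "covers_in (FS p) (fine_spectrum p G) (fine_spectrum p H) \<longleftrightarrow>
    (\<exists>!n. fine_spectrum_n p n G \<noteq> fine_spectrum_n p n H) \<and>
    (\<forall>n. fine_spectrum_n p n G \<noteq> fine_spectrum_n p n H \<longrightarrow>
       covers_in (equivs (bracketings_n p n)) (fine_spectrum_n p n G) (fine_spectrum_n p n H))"
  using covers_in_FS_iff[OF fine_spectrum_in_FS[OF assms(2)] fine_spectrum_in_FS[OF assms(3)]]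
  by (simp add: fine_spectrum_n_def level_def)

end
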